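(* Let $d\ge 2$ be an integer. There exist $n_0(d)$ and a constant $C_d>0$ such that for all $n\ge n_0(d)$ the following holds. Let $\mathcal{F}\subseteq\binom{[n]}{d+1}$ be such that for every $F\in\mathcal{F}$ there exists a subset $B_F\subseteq F$ with $|B_F|=1$ such that $F\cap F'\neq B_F$ for all $F'\in\mathcal{F}$. Then either $\mathcal{F}$ is a star (all members contain a common element) and $|\mathcal{F}|\le\binom{n-1}{d}$, or $|\mathcal{F}|\le\binom{n-1}{d}-C_d n^{d-1}$. In particular, $|\mathcal{F}|\le \binom{n-1}{d}$.
   Context: $\binom{[n]}{k}$ denotes the family of all $k$-element subsets of $[n]=\{1,\dots,n\}$. *)

theory Defs
  imports Complex_Main
begin

definition ksubsets :: "nat \<Rightarrow> nat \<Rightarrow> nat set set" where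
  "ksubsets n k = {A. A \<subseteq> {1..n} \<and> card A = k}"

end

theory Submission
  imports Defs
begin

text \<open>Let \<open>b F\<close> be the point of \<open>B\<^sub>F\<close> and call \<open>y\<close> big if some \<open>z y \<noteq> y\<close> lies in every member
  through \<open>y\<close>. Only \<open>O(n\<^sup>d\<^sup>-\<^sup>1)\<close> members have \<open>b F\<close> not big, and up to \<open>O(n\<^sup>d\<^sup>-\<^sup>1)\<close> further ones the map
  \<open>F \<mapsto> F - {z (b F)}\<close> is injective with values in the \<open>d\<close>-sets that contain a big point and
  on whose big points \<open>z\<close> is constant. If the family is nearly as large as a full star, then
  almost all \<open>d\<close>-sets are of this kind, which forces \<open>z\<close> to take a single value \<open>x\<close> on all but a
  small proportion of the points. Let \<open>D\<close> be the set of these points and \<open>Y = {b F | x \<notin> F}\<close>.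
  All sets \<open>{x, y} \<union> H\<close> with \<open>y \<in> Y\<close> and \<open>H \<subseteq> D\<close> are missing from the family, and since members
  avoiding \<open>x\<close> live in the small complement of \<open>D\<close>, this loss outweighs their number as soon as
  there is one.\<close>

section \<open>Counting sets that contain prescribed points\<close>

lemma card_Collect_ksubsets:
  "card {A. A \<subseteq> {1..n::nat} \<and> card A = k} = n choose k"
  using n_subsets[of "{1..n}" k] by simp

lemma choose_le_power: "n choose k \<le> n ^ k"
  by (cases "k \<le> n") (simp_all add: binomial_le_pow binomial_eq_0)

text \<open>Removing \<open>W\<close> injects these sets into the subsets of \<open>X\<close> of
  size \<open>k - card W\<close>. Multiplying out instead of subtracting exponents keeps the bound
  valid when \<open>card W > k\<close>, where no such \<open>G\<close> exists.\<close>

lemma card_supersets_le: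
  fixes X W :: "'a set"
  assumes X: "finite X" and W: "finite W"
  shows "card {G. G \<subseteq> X \<and> card G = k \<and> W \<subseteq> G} * card X ^ card W \<le> card X ^ k"
proof (cases "{G. G \<subseteq> X \<and> card G = k \<and> W \<subseteq> G} = {}")
  case False
  then obtain G where G: "G \<subseteq> X" "card G = k" "W \<subseteq> G" by auto
  have jk: "card W \<le> k" using G X by (metis card_mono finite_subset)
  let ?S = "{G. G \<subseteq> X \<and> card G = k \<and> W \<subseteq> G}"
  let ?T = "{H. H \<subseteq> X \<and> card H = k - card W}"
  have "card ?S \<le> card ?T"
  proof (rule card_inj_on_le[where f = "\<lambda>G. G - W"])
    show "inj_on (\<lambda>G. G - W) ?S" by (auto simp: inj_on_def)
    show "(\<lambda>G. G - W) ` ?S \<subseteq> ?T" using W by (auto simp: card_Diff_subset)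
    show "finite ?T" using X by simp
  qed
  also have "card ?T \<le> card X ^ (k - card W)"
    using n_subsets[OF X] choose_le_power by simp
  finally have "card ?S * card X ^ card W \<le> card X ^ (k - card W) * card X ^ card W"
    by simp
  also have "\<dots> = card X ^ k" using jk by (simp flip: power_add)
  finally show ?thesis .
next
  case True
  show ?thesis unfolding True by simp
qed

text \<open>A union bound over the possible witnesses \<open>W i\<close>; every counting of
  exceptional members below goes through it. The real quotient is deliberate: \<open>j\<close> may
  exceed \<open>k\<close>, as with \<open>d = 2\<close> and four prescribed points, where a
  truncated exponent \<open>k - j\<close> would spoil the bound.\<close>

lemma card_cover_le:
  fixes X :: "'a set" and W :: "'i \<Rightarrow> 'a set"
  assumes X: "finite X" "X \<noteq> {}" and I: "finite I"
    and W: "\<And>i. i \<in> I \<Longrightarrow> finite (W i) \<and> card (W i) = j"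
    and GG: "\<And>G. G \<in> \<G> \<Longrightarrow> G \<subseteq> X \<and> card G = k \<and> (\<exists>i\<in>I. W i \<subseteq> G)"
  shows "real (card \<G>) \<le> real (card I) * real (card X) ^ k / real (card X) ^ j"
proof -
  let ?S = "\<lambda>i. {G. G \<subseteq> X \<and> card G = k \<and> W i \<subseteq> G}"
  have n: "card X > 0" using X by (simp add: card_gt_0_iff)
  have "card \<G> \<le> card (\<Union>i\<in>I. ?S i)"
  proof (rule card_mono)
    show "finite (\<Union>i\<in>I. ?S i)" using X(1) I by simp
    show "\<G> \<subseteq> (\<Union>i\<in>I. ?S i)" using GG by blast
  qed
  also have "\<dots> \<le> (\<Sum>i\<in>I. card (?S i))" using I by (rule card_UN_le)
  finally have "real (card \<G>) \<le> (\<Sum>i\<in>I. real (card (?S i)))"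
    by (simp flip: of_nat_sum)
  also have "\<dots> \<le> (\<Sum>i\<in>I. real (card X) ^ k / real (card X) ^ j)"
  proof (rule sum_mono)
    fix i assume i: "i \<in> I"
    have "card (?S i) * card X ^ j \<le> card X ^ k"
      using card_supersets_le[OF X(1), of "W i" k] W[OF i] by simp
    then have "real (card (?S i)) * real (card X) ^ j \<le> real (card X) ^ k"
      by (simp flip: of_nat_mult of_nat_power)
    then show "real (card (?S i)) \<le> real (card X) ^ k / real (card X) ^ j"
      using n by (simp add: field_simps)
  qed
  also have "\<dots> = real (card I) * real (card X) ^ k / real (card X) ^ j" by simp
  finally show ?thesis .
qed

section \<open>Big points and members whose point \<open>b F\<close> is not big\<close>

locale singleton_avoiding =
  fixes n d :: nat and \<F> :: "nat set set" and b :: "nat set \<Rightarrow> nat"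
  assumes d2: "d \<ge> 2" and n2: "n \<ge> 2"
    and sub: "\<F> \<subseteq> ksubsets n (d + 1)"
    and b_in: "F \<in> \<F> \<Longrightarrow> b F \<in> F"
    and avoid: "F \<in> \<F> \<Longrightarrow> F' \<in> \<F> \<Longrightarrow> F \<inter> F' \<noteq> {b F}"
begin

lemma memD:
  assumes "F \<in> \<F>" shows "F \<subseteq> {1..n}" "card F = d + 1" "finite F"
  using sub assms finite_subset[of F "{1..n}"] by (auto simp: ksubsets_def)

lemma finite_family: "finite \<F>"
  by (rule finite_subset[of _ "Pow {1..n}"]) (use memD in auto)

definition Big :: "nat set" where
  "Big = {y \<in> {1..n}. \<exists>z\<in>{1..n}. z \<noteq> y \<and> (\<forall>F\<in>\<F>. y \<in> F \<longrightarrow> z \<in> F)}"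

text \<open>Meaningful only on \<open>Big\<close>; elsewhere the value is arbitrary, so every later
  use is restricted to big points.\<close>

definition z :: "nat \<Rightarrow> nat" where
  "z y = (SOME z. z \<in> {1..n} \<and> z \<noteq> y \<and> (\<forall>F\<in>\<F>. y \<in> F \<longrightarrow> z \<in> F))"

lemma zD:
  assumes "y \<in> Big"
  shows "z y \<in> {1..n}" "z y \<noteq> y" "F \<in> \<F> \<Longrightarrow> y \<in> F \<Longrightarrow> z y \<in> F"
proof -
  have "\<exists>z. z \<in> {1..n} \<and> z \<noteq> y \<and> (\<forall>F\<in>\<F>. y \<in> F \<longrightarrow> z \<in> F)"
    using assms unfolding Big_def by blast
  from someI_ex[OF this]
  show "z y \<in> {1..n}" "z y \<noteq> y" "F \<in> \<F> \<Longrightarrow> y \<in> F \<Longrightarrow> z y \<in> F"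
    unfolding z_def by blast+
qed

lemma Big_sub: "Big \<subseteq> {1..n}"
  unfolding Big_def by (rule Collect_subset)

lemma finite_Big: "finite Big"
  by (rule finite_subset[OF Big_sub]) simp

text \<open>If no point lies in all members through \<open>y\<close>, a member with \<open>b F = y\<close> meets a fixed
  member \<open>G\<close> in a further point \<open>u\<close>, and then meets a member avoiding \<open>u\<close> in a third point.\<close>

lemma card_not_Big_fibre:
  assumes y: "y \<in> {1..n}" "y \<notin> Big"
  shows "real (card {F\<in>\<F>. b F = y}) \<le> real (d * d) * real n ^ (d + 1) / real n ^ 3"
proof (cases "\<exists>G\<in>\<F>. y \<in> G")
  case False
  then have *: "{F\<in>\<F>. b F = y} = {}" using b_in by auto
  show ?thesis unfolding * by simp
next
  case True
  then obtain G where G: "G \<in> \<F>" "y \<in> G" by auto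
  have "\<exists>H\<in>\<F>. y \<in> H \<and> u \<notin> H" if "u \<in> G - {y}" for u
    using that y memD(1)[OF G(1)] unfolding Big_def by blast
  then obtain H where H: "\<And>u. u \<in> G - {y} \<Longrightarrow> H u \<in> \<F> \<and> y \<in> H u \<and> u \<notin> H u" by metis
  \<comment> \<open>There are \<open>d\<close> choices of \<open>u\<close> and then \<open>d\<close>
    of \<open>v\<close>; since \<open>H u\<close> misses \<open>u\<close>, the points
    \<open>y\<close>, \<open>u\<close>, \<open>v\<close> are distinct.\<close>
  let ?I = "SIGMA u:G - {y}. H u - {y}"
  let ?W = "\<lambda>(u,v). {y,u,v}"
  have finG: "finite (G - {y})" "\<forall>u\<in>G - {y}. finite (H u - {y})"
    using memD(3) G(1) H by blast+
  then have fin: "finite ?I" by blast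
  have cH: "card (H u - {y}) = d" if "u \<in> G - {y}" for u
    using H[OF that] memD(2)[of "H u"] by simp
  have "card (G - {y}) = d" using G memD(2)[of G] by simp
  moreover have "card ?I = (\<Sum>u\<in>G - {y}. card (H u - {y}))"
    using finG by (rule card_SigmaI)
  moreover have "\<dots> = (\<Sum>u\<in>G - {y}. d)" by (rule sum.cong[OF refl]) (rule cH)
  ultimately have cI: "card ?I = d * d" by simp
  have "real (card {F\<in>\<F>. b F = y}) \<le> real (card ?I) * real (card {1..n}) ^ (d + 1) / real (card {1..n}) ^ 3"
  proof (rule card_cover_le[where W = ?W])
    show "finite (?W i) \<and> card (?W i) = 3" if "i \<in> ?I" for i
    proof -
      obtain u v where "i = (u,v)" "u \<in> G - {y}" "v \<in> H u - {y}" using \<open>i \<in> ?I\<close> by auto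
      moreover from this have "u \<noteq> v" using H[of u] by blast
      ultimately show ?thesis by simp
    qed
    show "F \<subseteq> {1..n} \<and> card F = d + 1 \<and> (\<exists>i\<in>?I. ?W i \<subseteq> F)" if "F \<in> {F\<in>\<F>. b F = y}" for F
    proof -
      have F: "F \<in> \<F>" "b F = y" "y \<in> F" using that b_in by auto
      have meet: "\<exists>u\<in>K - {y}. u \<in> F" if "K \<in> \<F>" "y \<in> K" for K
        using avoid[OF F(1) that(1)] F that by blast
      obtain u where u: "u \<in> G - {y}" "u \<in> F" using meet[OF G] by blast
      obtain v where v: "v \<in> H u - {y}" "v \<in> F" using meet[of "H u"] H[OF u(1)] by blast
      have "(u,v) \<in> ?I" "?W (u,v) \<subseteq> F" using u v F(3) by auto
      then show ?thesis using memD[OF F(1)] by blast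
    qed
    show "{1..n} \<noteq> {}" using n2 by simp
  qed (rule fin finite_atLeastAtMost)+
  then show ?thesis using cI by simp
qed

text \<open>Sums the fibre bound, of order \<open>n ^ (d - 2)\<close>, over at most \<open>n\<close>
  values of \<open>b F\<close>.\<close>

lemma card_not_Big:
  "real (card {F\<in>\<F>. b F \<notin> Big}) \<le> real (d * d) * real n ^ (d - 1)"
proof -
  let ?A = "\<lambda>y. {F\<in>\<F>. b F = y}"
  have "{F\<in>\<F>. b F \<notin> Big} = (\<Union>y\<in>{1..n} - Big. ?A y)"
    using b_in memD(1) by blast
  then have "card {F\<in>\<F>. b F \<notin> Big} \<le> (\<Sum>y\<in>{1..n} - Big. card (?A y))"
    by (simp add: card_UN_le)
  then have "real (card {F\<in>\<F>. b F \<notin> Big}) \<le> (\<Sum>y\<in>{1..n} - Big. real (card (?A y)))"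
    by (simp flip: of_nat_sum)
  also have "\<dots> \<le> (\<Sum>y\<in>{1..n} - Big. real (d * d) * real n ^ (d + 1) / real n ^ 3)"
    by (rule sum_mono) (use card_not_Big_fibre in auto)
  also have "\<dots> \<le> real n * (real (d * d) * real n ^ (d + 1) / real n ^ 3)"
    using card_mono[of "{1..n}" "{1..n} - Big"]
    by (simp add: mult_right_mono divide_right_mono del: of_nat_mult)
  also have "\<dots> = real (d * d) * real n ^ (d - 1)"
  proof -
    obtain e where "d = Suc e" using d2 by (cases d) auto
    then show ?thesis using n2 by (simp add: field_simps power3_eq_cube)
  qed
  finally show ?thesis .
qed

section \<open>Typical members and bad \<open>d\<close>-sets\<close>

text \<open>The point \<open>z (b F)\<close> is exempted because it may itself be big, and
  \<open>z\<close> never fixes a big point.\<close>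

definition Typical :: "nat set set" where
  "Typical = {F\<in>\<F>. b F \<in> Big \<and> (\<forall>y\<in>F \<inter> Big. y \<noteq> z (b F) \<longrightarrow> z y = z (b F))}"

text \<open>A point \<open>y\<close> that violates typicality puts determined points into
  \<open>F\<close>. If \<open>z y = b F\<close>, these are the three points \<open>y\<close>,
  \<open>z y\<close>, \<open>z (z y)\<close>, determined by \<open>y\<close> alone. Otherwise
  \<open>b F\<close>, \<open>z (b F)\<close>, \<open>y\<close>, \<open>z y\<close> are four distinct
  points determined by a pair. Each case accounts for at most \<open>n ^ (d - 1)\<close>
  members.\<close>

lemma card_not_Typical:
  "real (card {F\<in>\<F>. b F \<in> Big \<and> F \<notin> Typical}) \<le> 2 * real n ^ (d - 1)"
proof -
  let ?A1 = "{F\<in>\<F>. \<exists>y\<in>F \<inter> Big. z y \<in> Big \<and> z (z y) \<noteq> y}"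
  let ?I1 = "{y\<in>Big. z y \<in> Big \<and> z (z y) \<noteq> y}"
  let ?I2 = "{(y,y')\<in>Big \<times> Big. card {y, z y, y', z y'} = 4}"
  let ?A2 = "{F\<in>\<F>. \<exists>p\<in>?I2. {fst p, z (fst p), snd p, z (snd p)} \<subseteq> F}"
  have fin: "finite ?I1" "finite ?I2"
    using finite_Big finite_subset[of ?I2 "Big \<times> Big"] by auto
  have cB: "card Big \<le> n" using card_mono[OF _ Big_sub] by simp
  have I1: "card ?I1 \<le> n" using cB card_mono[OF finite_Big, of ?I1] by auto
  have "card ?I2 \<le> card (Big \<times> Big)" using finite_Big by (intro card_mono) auto
  also have "\<dots> \<le> n * n" using cB by (simp add: card_cartesian_product mult_mono)
  finally have I2: "card ?I2 \<le> n * n" .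
  have "{F\<in>\<F>. b F \<in> Big \<and> F \<notin> Typical} \<subseteq> ?A1 \<union> ?A2"
  proof
    fix F assume "F \<in> {F\<in>\<F>. b F \<in> Big \<and> F \<notin> Typical}"
    then obtain y where F: "F \<in> \<F>" "b F \<in> Big"
      and y: "y \<in> F" "y \<in> Big" "y \<noteq> z (b F)" "z y \<noteq> z (b F)"
      unfolding Typical_def by auto
    note bF = b_in[OF F(1)]
    have zz: "z y \<in> F" "z (b F) \<in> F" using zD F y bF by auto
    have ne: "z y \<noteq> y" "z (b F) \<noteq> b F" "y \<noteq> b F" using zD F y by auto
    show "F \<in> ?A1 \<union> ?A2"
    proof (cases "z y = b F")
      case True
      then have "z y \<in> Big" "z (z y) \<noteq> y" using F y(3) by auto
      then show ?thesis using F y by blast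
    next
      case False
      then have "card {b F, z (b F), y, z y} = 4" using ne y by auto
      then have "(b F, y) \<in> ?I2" using F y by auto
      moreover have "{fst (b F, y), z (fst (b F, y)), snd (b F, y), z (snd (b F, y))} \<subseteq> F"
        using bF y zz by simp
      ultimately have "F \<in> ?A2" using F(1) by blast
      then show ?thesis by blast
    qed
  qed
  then have "card {F\<in>\<F>. b F \<in> Big \<and> F \<notin> Typical} \<le> card ?A1 + card ?A2"
    using finite_family by (intro order_trans[OF card_mono card_Un_le]) auto
  then have "real (card {F\<in>\<F>. b F \<in> Big \<and> F \<notin> Typical}) \<le> real (card ?A1) + real (card ?A2)"
    by linarith
  also have "real (card ?A1) \<le> real (card ?I1) * real (card {1..n}) ^ (d + 1) / real (card {1..n}) ^ 3"
  proof (rule card_cover_le[where W = "\<lambda>y. {y, z y, z (z y)}"])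
    show "finite {y, z y, z (z y)} \<and> card {y, z y, z (z y)} = 3" if "y \<in> ?I1" for y
      using that zD(2)[of y] zD(2)[of "z y"] by auto
    show "F \<subseteq> {1..n} \<and> card F = d + 1 \<and> (\<exists>y\<in>?I1. {y, z y, z (z y)} \<subseteq> F)" if F: "F \<in> ?A1" for F
    proof -
      obtain y where y: "F \<in> \<F>" "y \<in> F" "y \<in> ?I1" using F by blast
      then have "z y \<in> F" "z (z y) \<in> F" using zD(3) by blast+
      then have "{y, z y, z (z y)} \<subseteq> F" using y by blast
      then show ?thesis using memD[OF y(1)] y(3) by blast
    qed
    show "{1..n} \<noteq> {}" using n2 by simp
  qed (rule fin finite_atLeastAtMost)+
  also have "\<dots> \<le> real n * real n ^ (d + 1) / real n ^ 3"
    using I1 by (simp add: divide_right_mono mult_right_mono)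
  also have "real (card ?A2) \<le> real (card ?I2) * real (card {1..n}) ^ (d + 1) / real (card {1..n}) ^ 4"
  proof (rule card_cover_le[where W = "\<lambda>p. {fst p, z (fst p), snd p, z (snd p)}"])
    show "finite {fst p, z (fst p), snd p, z (snd p)} \<and> card {fst p, z (fst p), snd p, z (snd p)} = 4"
      if "p \<in> ?I2" for p using that by auto
    show "F \<subseteq> {1..n} \<and> card F = d + 1 \<and> (\<exists>p\<in>?I2. {fst p, z (fst p), snd p, z (snd p)} \<subseteq> F)"
      if "F \<in> ?A2" for F using that memD(1,2)[of F] by blast
    show "{1..n} \<noteq> {}" using n2 by simp
  qed (rule fin finite_atLeastAtMost)+
  also have "\<dots> \<le> real (n * n) * real n ^ (d + 1) / real n ^ 4"
    using I2 by (simp add: divide_right_mono mult_right_mono flip: of_nat_mult)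
  also have "real n * real n ^ (d + 1) / real n ^ 3 + real (n * n) * real n ^ (d + 1) / real n ^ 4
    = 2 * real n ^ (d - 1)"
  proof -
    obtain e where "d = Suc e" using d2 by (cases d) auto
    then show ?thesis using n2 by (simp add: field_simps power3_eq_cube power4_eq_xxxx)
  qed
  finally show ?thesis by simp
qed

text \<open>The \<open>d\<close>-sets that cannot arise as \<open>F - {z (b F)}\<close> from a
  typical \<open>F\<close>.\<close>

definition Bad :: "nat set set" where
  "Bad = {G. G \<subseteq> {1..n} \<and> card G = d \<and>
     (G \<inter> Big = {} \<or> (\<exists>y\<in>G \<inter> Big. \<exists>y'\<in>G \<inter> Big. z y \<noteq> z y'))}"

lemma finite_Bad: "finite Bad"
  by (rule finite_subset[of _ "Pow {1..n}"]) (auto simp: Bad_def)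

text \<open>A typical \<open>F\<close> is recovered from \<open>F - {z (b F)}\<close>, whose big points all have the same image
  \<open>z (b F)\<close> under \<open>z\<close>.\<close>

lemma card_Typical: "card Typical + card Bad \<le> n choose d"
proof -
  let ?f = "\<lambda>F. F - {z (b F)}"
  let ?S = "{G. G \<subseteq> {1..n} \<and> card G = d}"
  have T: "F \<in> \<F>" "b F \<in> Big" "b F \<in> F" "z (b F) \<in> F" "z (b F) \<noteq> b F" if "F \<in> Typical" for F
    using that b_in zD unfolding Typical_def by auto
  have T2: "z y = z (b F)" if "F \<in> Typical" "y \<in> ?f F" "y \<in> Big" for F y
    using that unfolding Typical_def by auto
  have "inj_on ?f Typical"
  proof (rule inj_onI)
    fix F F' assume FF: "F \<in> Typical" "F' \<in> Typical" "?f F = ?f F'"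
    have "b F' \<in> ?f F" using T(3,5)[OF FF(2)] FF(3) by auto
    then have "z (b F') = z (b F)" using T2 FF T by metis
    then show "F = F'" using FF(3) T(4)[OF FF(1)] T(4)[OF FF(2)] by auto
  qed
  then have "card (?f ` Typical) = card Typical" by (rule card_image)
  moreover have "?f ` Typical \<subseteq> ?S"
  proof
    fix G assume "G \<in> ?f ` Typical"
    then obtain F where F: "F \<in> Typical" "G = ?f F" by auto
    show "G \<in> ?S" using memD(1,2)[OF T(1)[OF F(1)]] T(4)[OF F(1)] F(2) by auto
  qed
  moreover have "?f ` Typical \<inter> Bad = {}"
  proof -
    have "?f F \<notin> Bad" if F: "F \<in> Typical" for F
    proof
      assume "?f F \<in> Bad"
      moreover have "b F \<in> ?f F \<inter> Big" using T[OF F] by auto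
      ultimately obtain y y' where "y \<in> ?f F \<inter> Big" "y' \<in> ?f F \<inter> Big" "z y \<noteq> z y'"
        unfolding Bad_def by blast
      then show False using T2[OF F] by (metis IntD1 IntD2)
    qed
    then show ?thesis by auto
  qed
  moreover have "Bad \<subseteq> ?S" by (auto simp: Bad_def)
  moreover have fS: "finite ?S" by simp
  ultimately have "card Typical + card Bad = card (?f ` Typical \<union> Bad)"
    by (metis (no_types, lifting) card_Un_disjoint finite_subset)
  also have "\<dots> \<le> card ?S"
    by (intro card_mono fS Un_least \<open>?f ` Typical \<subseteq> ?S\<close> \<open>Bad \<subseteq> ?S\<close>)
  finally show ?thesis using card_Collect_ksubsets by simp
qed

text \<open>Read as stability: a family close to \<open>n choose d\<close> in size leaves only
  \<open>O(n ^ (d - 1))\<close> bad sets.\<close>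

lemma card_family_Bad:
  "real (card \<F>) + real (card Bad) \<le> real (n choose d) + real (d * d + 2) * real n ^ (d - 1)"
proof -
  have "\<F> = {F\<in>\<F>. b F \<notin> Big} \<union> {F\<in>\<F>. b F \<in> Big \<and> F \<notin> Typical} \<union> Typical"
    by (auto simp: Typical_def)
  then have "card \<F> \<le> card {F\<in>\<F>. b F \<notin> Big} + card {F\<in>\<F>. b F \<in> Big \<and> F \<notin> Typical} + card Typical"
    by (metis (no_types, lifting) add_le_mono1 card_Un_le le_trans)
  then have "real (card \<F>) \<le> real (card {F\<in>\<F>. b F \<notin> Big})
      + real (card {F\<in>\<F>. b F \<in> Big \<and> F \<notin> Typical}) + real (card Typical)" by linarith
  moreover have "real (card Typical) + real (card Bad) \<le> real (n choose d)"
    using card_Typical by linarith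
  ultimately show ?thesis using card_not_Big card_not_Typical by (simp add: algebra_simps)
qed

text \<open>Every \<open>d\<close>-set of points that are not big is bad, so few bad sets force
  almost all points to be big.\<close>

lemma choose_not_Big_le_Bad: "(n - card Big) choose d \<le> card Bad"
proof -
  have "card {G. G \<subseteq> {1..n} - Big \<and> card G = d} = card ({1..n} - Big) choose d"
    by (rule n_subsets) simp
  moreover have "card ({1..n} - Big) = n - card Big"
    using Big_sub finite_Big by (simp add: card_Diff_subset)
  moreover have "card {G. G \<subseteq> {1..n} - Big \<and> card G = d} \<le> card Bad"
    by (rule card_mono[OF finite_Bad]) (auto simp: Bad_def)
  ultimately show ?thesis by simp
qed

section \<open>The fibres of \<open>z\<close>\<close>

definition D :: "nat \<Rightarrow> nat set" where "D x = {y\<in>Big. z y = x}"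

lemma D_sub: "D x \<subseteq> Big" "D x \<subseteq> {1..n} - {x}" "finite (D x)"
proof -
  show "D x \<subseteq> Big" by (auto simp: D_def)
  then show "finite (D x)" by (rule finite_subset[OF _ finite_Big])
  have "x \<notin> D x" using zD(2)[of x] by (auto simp: D_def)
  then show "D x \<subseteq> {1..n} - {x}" using \<open>D x \<subseteq> Big\<close> Big_sub by auto
qed

text \<open>Double counting of bad sets \<open>G\<close> with an ordered pair of big points of
  \<open>G\<close> that have different images under \<open>z\<close>. Each big \<open>y\<close> has
  at least \<open>card Big - m\<close> partners, each pair extends by any \<open>d - 2\<close>
  further points, and a bad set carries at most \<open>d * d\<close> pairs.\<close>

lemma card_D_le_Bad:
  assumes m: "\<And>x. card (D x) \<le> m"
  shows "card Big * (card Big - m) * ((n - 2) choose (d - 2)) \<le> d * d * card Bad"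
proof -
  let ?P = "SIGMA y:Big. Big - D (z y)"
  let ?Q = "SIGMA p:?P. {H. H \<subseteq> {1..n} - {fst p, snd p} \<and> card H = d - 2}"
  let ?R = "SIGMA G:Bad. G \<times> G"
  let ?f = "\<lambda>((y,y'),H). (insert y (insert y' H), (y,y'))"
  have BadD: "finite G" "card G = d" if "G \<in> Bad" for G
    using that finite_subset[of G "{1..n}"] by (simp_all add: Bad_def)
  have fB: "finite (Big - X)" for X using finite_Big by simp
  have fP: "finite ?P" by (rule finite_SigmaI[OF finite_Big fB])
  have pD: "fst p \<in> {1..n}" "snd p \<in> {1..n}" "fst p \<noteq> snd p" "fst p \<in> Big" "snd p \<in> Big"
    "z (fst p) \<noteq> z (snd p)" if p: "p \<in> ?P" for p
  proof -
    obtain y y' where "p = (y,y')" "y \<in> Big" "y' \<in> Big" "y' \<notin> D (z y)" using p by blast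
    moreover from this have "z y \<noteq> z y'" unfolding D_def by simp
    ultimately show "fst p \<in> {1..n}" "snd p \<in> {1..n}" "fst p \<noteq> snd p" "fst p \<in> Big"
      "snd p \<in> Big" "z (fst p) \<noteq> z (snd p)"
      using Big_sub by (simp_all add: subset_iff) metis
  qed
  have "card Big * (card Big - m) = (\<Sum>y\<in>Big. card Big - m)" by simp
  also have "\<dots> \<le> (\<Sum>y\<in>Big. card (Big - D (z y)))"
    using m D_sub by (intro sum_mono) (simp add: card_Diff_subset diff_le_mono2)
  also have "\<dots> = card ?P" using finite_Big fB by (intro card_SigmaI[symmetric]) auto
  finally have P: "card Big * (card Big - m) \<le> card ?P" .
  have cH: "card {H. H \<subseteq> {1..n} - {fst p, snd p} \<and> card H = d - 2} = (n - 2) choose (d - 2)"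
    if "p \<in> ?P" for p
    using pD[OF that] by (subst n_subsets) (auto simp: card_Diff_subset numeral_2_eq_2)
  have "card ?Q = (\<Sum>p\<in>?P. card {H. H \<subseteq> {1..n} - {fst p, snd p} \<and> card H = d - 2})"
    using fP by (intro card_SigmaI) auto
  also have "\<dots> = (\<Sum>p\<in>?P. (n - 2) choose (d - 2))" by (rule sum.cong[OF refl]) (rule cH)
  finally have "card ?Q = card ?P * ((n - 2) choose (d - 2))" by simp
  moreover have "card ?Q \<le> card ?R"
  proof (rule card_inj_on_le[where f = ?f])
    show "inj_on ?f ?Q"
    proof (rule inj_on_inverseI[where g = "\<lambda>(G,p). (p, G - {fst p, snd p})"])
      fix w assume "w \<in> ?Q"
      then obtain y y' H where w: "w = ((y,y'),H)" "H \<subseteq> {1..n} - {y,y'}"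
        by (elim SigmaE) simp
      then have "insert y (insert y' H) - {y,y'} = H" by blast
      then show "(\<lambda>(G,p). (p, G - {fst p, snd p})) (?f w) = w" using w by simp
    qed
    show "?f ` ?Q \<subseteq> ?R"
    proof
      fix w assume "w \<in> ?f ` ?Q"
      then obtain v where v: "v \<in> ?Q" "w = ?f v" by (rule imageE)
      obtain p H where vp: "v = (p, H)" by (cases v)
      have p: "p \<in> ?P" and H: "H \<subseteq> {1..n} - {fst p, snd p}" "card H = d - 2"
        using v(1) unfolding vp mem_Sigma_iff mem_Collect_eq by iprover+
      have w: "w = (insert (fst p) (insert (snd p) H), p)"
        using v(2) by (simp add: vp case_prod_beta)
      have "finite H" using finite_subset[OF H(1)] by simp
      then have "card (insert (fst p) (insert (snd p) H)) = d"
        using H pD[OF p] d2 by (auto simp: card_insert_if)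
      then have "insert (fst p) (insert (snd p) H) \<in> Bad"
        using pD[OF p] H unfolding Bad_def by blast
      moreover have "p \<in> insert (fst p) (insert (snd p) H) \<times> insert (fst p) (insert (snd p) H)"
        by (simp add: mem_Times_iff)
      ultimately show "w \<in> ?R" unfolding w by (rule SigmaI)
    qed
    show "finite ?R" using finite_Bad BadD by blast
  qed
  moreover have "card ?R = d * d * card Bad"
  proof -
    have "card ?R = (\<Sum>G\<in>Bad. card (G \<times> G))" using finite_Bad BadD by (intro card_SigmaI) auto
    also have "\<dots> = (\<Sum>G\<in>Bad. d * d)"
      by (rule sum.cong[OF refl]) (simp add: BadD card_cartesian_product)
    finally show ?thesis by simp
  qed
  ultimately have "card ?P * ((n - 2) choose (d - 2)) \<le> d * d * card Bad" by argo
  with mult_le_mono1[OF P] show ?thesis by (rule order_trans)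
qed

section \<open>The loss caused by a member that misses the common value\<close>

text \<open>If \<open>y = b F\<close> for a member \<open>F\<close> missing \<open>x\<close>, no member has the form \<open>{x, y} \<union> H\<close> with
  \<open>H \<subseteq> D x\<close>, since \<open>F\<close> is disjoint from \<open>D x\<close>.\<close>

lemma card_family_not_star:
  assumes x: "x \<in> {1..n}" and F0: "F0 \<in> \<F>" "x \<notin> F0"
    and r: "r = n - 1 - card (D x)"
    and ge: "real d * real r ^ (d - 1) \<le> real (card (D x) choose (d - 1))"
  shows "real (card \<F>) \<le> real ((n - 1) choose d)
    - (real (card (D x) choose (d - 1)) - real d * real r ^ (d - 1))"
proof -
  let ?R = "{1..n} - {x} - D x"
  let ?F1 = "{F\<in>\<F>. x \<in> F}" and ?F2 = "{F\<in>\<F>. x \<notin> F}"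
  let ?Y = "b ` ?F2"
  let ?Hs = "{H. H \<subseteq> D x \<and> card H = d - 1}"
  let ?S = "{G. G \<subseteq> {1..n} - {x} \<and> card G = d}"
  let ?c = "card (D x) choose (d - 1)"
  have cR: "card ?R = r" using x D_sub[of x] r by (simp add: card_Diff_subset)
  have F2R: "F \<subseteq> ?R" if "F \<in> ?F2" for F
  proof
    fix y assume "y \<in> F"
    \<comment> \<open>A point of \<open>D x\<close> would force its image \<open>x\<close> into
      \<open>F\<close>.\<close>
    moreover have "y \<notin> D x" using that zD(3)[of y F] \<open>y \<in> F\<close> unfolding D_def by blast
    ultimately show "y \<in> ?R" using that memD(1)[of F] by blast
  qed
  have YR: "?Y \<subseteq> ?R"
  proof (rule image_subsetI)
    fix F assume "F \<in> ?F2"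
    then show "b F \<in> ?R" using F2R[of F] b_in[of F] by blast
  qed
  have finY: "finite ?Y" using finite_family by simp
  have "?Y \<noteq> {}" using F0 by blast
  then have cY: "card ?Y \<ge> 1" using finY by (simp only: Suc_le_eq One_nat_def card_gt_0_iff simp_thms)
  \<comment> \<open>The traces \<open>F - {x}\<close> and the sets \<open>insert y H\<close> are
    disjoint families of \<open>d\<close>-subsets of \<open>{1..n} - {x}\<close>. The pair
    \<open>(y, H)\<close> is recoverable because \<open>?Y\<close> lies outside
    \<open>D x\<close>.\<close>
  have "card ?F1 + card ?Y * ?c \<le> (n - 1) choose d"
  proof -
    let ?g = "\<lambda>(y,H). insert y H"
    let ?f = "\<lambda>F. F - {x}"
    have "inj_on ?g (?Y \<times> ?Hs)"
    proof (rule inj_onI, clarify)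
      fix F H F' H'
      assume *: "F \<in> \<F>" "x \<notin> F" "F' \<in> \<F>" "x \<notin> F'" "H \<subseteq> D x" "H' \<subseteq> D x"
        "insert (b F) H = insert (b F') H'"
      have "b F \<in> ?R" "b F' \<in> ?R" using YR * by auto
      then have notin: "b F \<notin> H" "b F \<notin> H'" "b F' \<notin> H'" using * by auto
      then have "b F = b F'" using * by (metis insertE insertI1)
      then show "b F = b F' \<and> H = H'" using * notin by (metis insert_ident)
    qed
    then have "card (?g ` (?Y \<times> ?Hs)) = card (?Y \<times> ?Hs)" by (rule card_image)
    then have "card (?g ` (?Y \<times> ?Hs)) = card ?Y * ?c"
      using n_subsets[OF D_sub(3), of x "d - 1"] by (simp add: card_cartesian_product)
    moreover have "card (?f ` ?F1) = card ?F1" by (rule card_image) (auto simp: inj_on_def)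
    moreover have "?f ` ?F1 \<inter> ?g ` (?Y \<times> ?Hs) = {}"
    proof -
      have False if FF: "F \<in> \<F>" "x \<in> F" "F' \<in> ?F2" and H: "H \<in> ?Hs" and eq: "F - {x} = insert (b F') H"
        for F F' H
      proof -
        have "F' \<inter> H = {}" using F2R[OF FF(3)] H by auto
        moreover have "F = insert x (insert (b F') H)" using eq FF by auto
        ultimately have "F' \<inter> F = {b F'}" using FF b_in by auto
        then show False using avoid FF by auto
      qed
      then show ?thesis by blast
    qed
    moreover have sub1: "?f ` ?F1 \<subseteq> ?S"
    proof (rule image_subsetI)
      fix F assume "F \<in> ?F1"
      then show "F - {x} \<in> ?S" using memD(1,2)[of F] by auto
    qed
    moreover have sub2: "?g ` (?Y \<times> ?Hs) \<subseteq> ?S"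
    proof
      fix G assume "G \<in> ?g ` (?Y \<times> ?Hs)"
      then obtain y H where G: "y \<in> ?Y" "H \<subseteq> D x" "card H = d - 1" "G = insert y H" by auto
      have "finite H" by (rule finite_subset[OF G(2) D_sub(3)])
      moreover have "y \<notin> H" using G YR by blast
      ultimately have "card G = d" using G d2 by simp
      moreover have "G \<subseteq> {1..n} - {x}" using G YR D_sub(2)[of x] by blast
      ultimately show "G \<in> ?S" by blast
    qed
    moreover have fS: "finite ?S" by simp
    ultimately have "card ?F1 + card ?Y * ?c = card (?f ` ?F1 \<union> ?g ` (?Y \<times> ?Hs))"
      by (metis (no_types, lifting) card_Un_disjoint finite_subset)
    also have "\<dots> \<le> card ?S" by (intro card_mono fS Un_least sub1 sub2)
    also have "\<dots> = (n - 1) choose d" using x by (subst n_subsets) auto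
    finally show ?thesis .
  qed
  then have 1: "real (card ?F1) + real (card ?Y) * real ?c \<le> real ((n - 1) choose d)"
    by (simp flip: of_nat_add of_nat_mult)
  have "card ?F2 \<le> (\<Sum>y\<in>?Y. card {F\<in>?F2. b F = y})"
  proof -
    have "?F2 = (\<Union>y\<in>?Y. {F\<in>?F2. b F = y})" by auto
    then show ?thesis using card_UN_le[OF finY, of "\<lambda>y. {F\<in>?F2. b F = y}"] by simp
  qed
  then have "real (card ?F2) \<le> (\<Sum>y\<in>?Y. real (card {F\<in>?F2. b F = y}))"
    by (simp flip: of_nat_sum)
  also have "\<dots> \<le> (\<Sum>y\<in>?Y. real d * real r ^ (d - 1))"
  proof (rule sum_mono)
    fix y assume "y \<in> ?Y"
    then obtain G where G: "G \<in> ?F2" "b G = y" by auto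
    have yG: "y \<in> G" using G b_in by auto
    have Rne: "?R \<noteq> {}" using F2R[OF G(1)] yG by blast
    then have r0: "r > 0" unfolding cR[symmetric] by (simp only: card_gt_0_iff) simp
    have cG: "card (G - {y}) = d" using G yG memD(2)[of G] by simp
    \<comment> \<open>All these members lie in the \<open>r\<close> points of \<open>?R\<close>,
      contain \<open>y\<close>, and meet the fixed member \<open>G\<close> in one of its
      \<open>d\<close> other points.\<close>
    have "real (card {F\<in>?F2. b F = y}) \<le> real (card (G - {y})) * real (card ?R) ^ (d + 1) / real (card ?R) ^ 2"
    proof (rule card_cover_le[where W = "\<lambda>u. {y,u}"])
      show "?R \<noteq> {}" by (rule Rne)
      show "F \<subseteq> ?R \<and> card F = d + 1 \<and> (\<exists>u\<in>G - {y}. {y,u} \<subseteq> F)" if F: "F \<in> {F\<in>?F2. b F = y}" for F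
      proof -
        have "y \<in> F" using F b_in by auto
        moreover have "\<exists>u\<in>G - {y}. u \<in> F" using avoid[of F G] F G yG \<open>y \<in> F\<close> by blast
        ultimately show ?thesis using F F2R[of F] memD(2)[of F] by blast
      qed
      show "finite (G - {y})" using memD(3) G by simp
      show "finite {y,u} \<and> card {y,u} = 2" if "u \<in> G - {y}" for u using that by auto
    qed simp
    also have "\<dots> = real d * real r ^ (d - 1)"
    proof -
      obtain e where "d = Suc e" using d2 by (cases d) auto
      then show ?thesis using r0 unfolding cG cR by (simp add: field_simps power2_eq_square)
    qed
    finally show "real (card {F\<in>?F2. b F = y}) \<le> real d * real r ^ (d - 1)" .
  qed
  also have "\<dots> = real (card ?Y) * (real d * real r ^ (d - 1))" by simp
  finally have 2: "real (card ?F2) \<le> real (card ?Y) * (real d * real r ^ (d - 1))" .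
  have "\<F> = ?F1 \<union> ?F2" by auto
  then have "card \<F> \<le> card ?F1 + card ?F2" by (metis (no_types, lifting) card_Un_le)
  then have "real (card \<F>) \<le> real (card ?F1) + real (card ?F2)" by linarith
  also have "\<dots> \<le> real ((n - 1) choose d) - real (card ?Y) * (real ?c - real d * real r ^ (d - 1))"
    using 1 2 by (simp add: algebra_simps)
  also have "\<dots> \<le> real ((n - 1) choose d) - (real ?c - real d * real r ^ (d - 1))"
  proof -
    \<comment> \<open>The assumption \<open>ge\<close> makes the net loss per point of
      \<open>?Y\<close> nonnegative, so a single point may stand for all of them.\<close>
    have "1 * (real ?c - real d * real r ^ (d - 1)) \<le> real (card ?Y) * (real ?c - real d * real r ^ (d - 1))"
      using cY ge by (intro mult_right_mono) auto
    then show ?thesis by simp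
  qed
  finally show ?thesis .
qed

lemma card_star:
  assumes "\<forall>F\<in>\<F>. x \<in> F"
  shows "card \<F> \<le> (n - 1) choose d"
proof (cases "\<F> = {}")
  case False
  then have x: "x \<in> {1..n}" using assms memD(1) by blast
  have "card \<F> \<le> card {G. G \<subseteq> {1..n} - {x} \<and> card G = d}"
  proof (rule card_inj_on_le[where f = "\<lambda>F. F - {x}"])
    show "inj_on (\<lambda>F. F - {x}) \<F>" using assms by (auto simp: inj_on_def)
    show "(\<lambda>F. F - {x}) ` \<F> \<subseteq> {G. G \<subseteq> {1..n} - {x} \<and> card G = d}"
      using assms memD by auto
  qed simp
  also have "\<dots> = (n - 1) choose d" using x by (subst n_subsets) auto
  finally show ?thesis .
qed simp

end

section \<open>Choice of constants and conclusion\<close>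

theorem theorem5p2:
  fixes d :: nat
  assumes "d \<ge> 2"
  shows "\<exists>n0 :: nat. \<exists>C :: real. C > 0 \<and>
    (\<forall>n \<ge> n0. \<forall>\<F>. \<F> \<subseteq> ksubsets n (d + 1) \<longrightarrow>
      (\<forall>F\<in>\<F>. \<exists>B. B \<subseteq> F \<and> card B = 1 \<and> (\<forall>F'\<in>\<F>. F \<inter> F' \<noteq> B)) \<longrightarrow>
      ((((\<exists>x. \<forall>F\<in>\<F>. x \<in> F) \<and> card \<F> \<le> (n - 1) choose d)
        \<or> real (card \<F>) \<le> real ((n - 1) choose d) - C * real n ^ (d - 1))
       \<and> card \<F> \<le> (n - 1) choose d))"
proof -
  \<comment> \<open>\<open>K\<close> bounds the bad sets in units of \<open>n ^ (d - 1)\<close>: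
    \<open>d * d + 2\<close> exceptional members, one unit for passing from
    \<open>n choose d\<close> to \<open>(n - 1) choose d\<close>, one for \<open>C \<le> 1\<close>.
    The first two summands of \<open>P\<close> are the thresholds contradicted in \<open>few\<close>
    and \<open>large\<close>. \<open>C\<close> is half the coefficient in the lower bound for
    \<open>card (D x) choose (d - 1)\<close>; the other half pays for the members avoiding
    \<open>x\<close>.\<close>
  define K :: real where "K = real d * real d + 4"
  define P :: real where "P = K * (8 * real d ^ 3) ^ d + 16 * real d ^ 4 * K * (2 * real d) ^ (d - 2) + 8"
  define C :: real where "C = (1 / (2 * real d)) ^ (d - 1) / 2"
  obtain n0 :: nat where n0: "real n0 > P" using reals_Archimedean2 by blast
  have C: "C > 0" "C \<le> 1"
  proof -
    show "C > 0" using assms unfolding C_def by simp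
    have "(1 / (2 * real d)) ^ (d - 1) \<le> 1" using assms by (intro power_le_one) simp_all
    then show "C \<le> 1" unfolding C_def by simp
  qed
  have main: "((\<exists>x. \<forall>F\<in>\<F>. x \<in> F) \<and> card \<F> \<le> (n - 1) choose d)
      \<or> real (card \<F>) \<le> real ((n - 1) choose d) - C * real n ^ (d - 1)"
    if n: "n \<ge> n0" and sub: "\<F> \<subseteq> ksubsets n (d + 1)"
      and B: "\<forall>F\<in>\<F>. \<exists>B. B \<subseteq> F \<and> card B = 1 \<and> (\<forall>F'\<in>\<F>. F \<inter> F' \<noteq> B)" for n \<F>
  proof -
    have "\<exists>y. y \<in> F \<and> (\<forall>F'\<in>\<F>. F \<inter> F' \<noteq> {y})" if "F \<in> \<F>" for F
      using B[rule_format, OF that] by (auto simp: card_1_singleton_iff)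
    then obtain b where b: "\<And>F. F \<in> \<F> \<Longrightarrow> b F \<in> F \<and> (\<forall>F'\<in>\<F>. F \<inter> F' \<noteq> {b F})"
      by metis
    have K4: "K \<ge> 4" unfolding K_def by simp
    have nP: "real n > P" using n n0 by linarith
    have P1: "K * (8 * real d ^ 3) ^ d \<le> P" "16 * real d ^ 4 * K * (2 * real d) ^ (d - 2) \<le> P" "8 \<le> P"
      using K4 unfolding P_def by simp_all
    interpret singleton_avoiding n d \<F> b
      using assms sub b nP P1(3) by unfold_locales auto
    show ?thesis
    proof (cases "real (card \<F>) \<le> real ((n - 1) choose d) - C * real n ^ (d - 1)")
      case False
      have "real n ^ (d - 1) * C \<le> real n ^ (d - 1)" using C by (simp add: mult_left_le)
      moreover have "real (n choose d) \<le> real ((n - 1) choose d) + real n ^ (d - 1)"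
      proof -
        have "n choose d = ((n - 1) choose (d - 1)) + ((n - 1) choose d)"
          using n2 d2 by (intro choose_reduce_nat) auto
        moreover have "(n - 1) choose (d - 1) \<le> n ^ (d - 1)"
          using choose_le_power[of "n - 1" "d - 1"] power_mono[of "n - 1" n "d - 1"] by simp
        ultimately have "n choose d \<le> ((n - 1) choose d) + n ^ (d - 1)" by linarith
        then show ?thesis by (simp flip: of_nat_add of_nat_power)
      qed
      ultimately have bad: "real (card Bad) \<le> K * real n ^ (d - 1)"
        using False card_family_Bad unfolding K_def by (simp add: algebra_simps)
      \<comment> \<open>The most frequent value of \<open>z\<close> is the candidate for the centre
        of the star.\<close>
      obtain x where x: "x \<in> {1..n}" and xmax: "\<And>x'. x' \<in> {1..n} \<Longrightarrow> card (D x') \<le> card (D x)"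
      proof -
        have "Max ((\<lambda>x. card (D x)) ` {1..n}) \<in> (\<lambda>x. card (D x)) ` {1..n}"
          using n2 by (intro Max_in) auto
        then obtain x where "x \<in> {1..n}" "Max ((\<lambda>x. card (D x)) ` {1..n}) = card (D x)" by (rule imageE)
        moreover have "card (D x') \<le> Max ((\<lambda>x. card (D x)) ` {1..n})" if "x' \<in> {1..n}" for x'
          using that by (intro Max_ge) auto
        ultimately show ?thesis using that[of x] by simp
      qed
      have max: "card (D x') \<le> card (D x)" for x'
      proof (cases "x' \<in> {1..n}")
        case False
        then have "D x' = {}" using zD(1) by (auto simp: D_def)
        then show ?thesis by simp
      qed (rule xmax)
      have big_n: "8 * real d ^ 3 \<le> real n"
      proof -
        have "8 * real d ^ 3 \<le> (8 * real d ^ 3) ^ d"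
        proof (rule self_le_power)
          have "1 \<le> real d ^ 3" using d2 by (intro one_le_power) simp
          then show "1 \<le> 8 * real d ^ 3" by linarith
        qed (use d2 in simp)
        also have "\<dots> \<le> K * (8 * real d ^ 3) ^ d" using K4 mult_right_mono[of 1 K "(8 * real d ^ 3) ^ d"] by simp
        finally show ?thesis using nP P1 by linarith
      qed
      have dn: "2 * d \<le> n"
      proof -
        have "real d \<le> real d ^ 3" using d2 by (intro self_le_power) simp_all
        then have "2 * real d \<le> 8 * real d ^ 3" by linarith
        then show ?thesis using big_n by linarith
      qed
      \<comment> \<open>Otherwise the \<open>d\<close>-sets of points that are not big would alone
        number a constant times \<open>n ^ d\<close>, too many for \<open>bad\<close>.\<close>
      have few: "real (n - card Big) \<le> real n / (8 * real d ^ 2)"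
      proof (rule ccontr)
        let ?s = "n - card Big"
        assume s: "\<not> ?thesis"
        have "real d \<le> real n / (8 * real d ^ 2)"
          using big_n d2 by (simp add: field_simps power2_eq_square power3_eq_cube)
        then have "d \<le> ?s" using s by linarith
        have "(real n / (8 * real d ^ 3)) ^ d \<le> (real ?s / real d) ^ d"
        proof (rule power_mono)
          have "real n / (8 * real d ^ 3) = real n / (8 * real d ^ 2) / real d"
            by (simp add: power2_eq_square power3_eq_cube)
          also have "\<dots> \<le> real ?s / real d" using s by (intro divide_right_mono) linarith+
          finally show "real n / (8 * real d ^ 3) \<le> real ?s / real d" .
        qed simp
        also have "\<dots> \<le> real (?s choose d)" by (rule binomial_ge_n_over_k_pow_k[OF \<open>d \<le> ?s\<close>])
        also have "\<dots> \<le> K * real n ^ (d - 1)"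
          using choose_not_Big_le_Bad bad by linarith
        finally have "real n ^ d \<le> K * (8 * real d ^ 3) ^ d * real n ^ (d - 1)"
          using d2 by (simp add: power_divide field_simps)
        moreover have "real n ^ d = real n * real n ^ (d - 1)"
          using d2 by (cases d) auto
        ultimately have "real n \<le> K * (8 * real d ^ 3) ^ d" using n2 by simp
        then show False using nP P1 by linarith
      qed
      have d2r: "8 * real d ^ 2 \<ge> 32"
        using power_mono[of 2 "real d" 2] d2 by simp
      have le32: "real n / (8 * real d ^ 2) \<le> real n / 32"
        using d2r d2 by (intro divide_left_mono) auto
      have cB: "card Big \<le> n" using card_mono[OF _ Big_sub] by simp
      have cD: "card (D x) \<le> card Big" by (rule card_mono[OF finite_Big D_sub(1)])
      have half: "real (card Big) \<ge> real n / 2"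
        using few le32 cB by linarith
      \<comment> \<open>If many big points lay outside the largest fibre, then so many pairs of big
        points would have different images that the double count would contradict
        \<open>bad\<close>.\<close>
      have large: "real (card Big - card (D x)) \<le> real n / (8 * real d ^ 2)"
      proof (rule ccontr)
        let ?t = "card Big - card (D x)"
        assume t: "\<not> ?thesis"
        \<comment> \<open>The case \<open>d = 2\<close> is separate because the binomial estimate
          would divide by \<open>d - 2\<close>.\<close>
        have "(real n / (2 * real d)) ^ (d - 2) \<le> real ((n - 2) choose (d - 2))"
        proof (cases "d = 2")
          case False
          have "(real n / (2 * real d)) ^ (d - 2) \<le> (real (n - 2) / real (d - 2)) ^ (d - 2)"
          proof (rule power_mono)
            have "real n / (2 * real d) = (real n / 2) / real d" by simp
            also have "\<dots> \<le> real (n - 2) / real (d - 2)"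
              using nP P1(3) d2 False by (intro frac_le) auto
            finally show "real n / (2 * real d) \<le> real (n - 2) / real (d - 2)" .
          qed simp
          also have "\<dots> \<le> real ((n - 2) choose (d - 2))"
            using dn by (intro binomial_ge_n_over_k_pow_k) auto
          finally show ?thesis .
        qed simp
        then have "(real n / 2) * (real n / (8 * real d ^ 2)) * (real n / (2 * real d)) ^ (d - 2)
            \<le> real (card Big) * real ?t * real ((n - 2) choose (d - 2))"
          using half t by (intro mult_mono) auto
        also have "\<dots> \<le> real d * real d * real (card Bad)"
          using card_D_le_Bad[OF max] by (simp flip: of_nat_mult)
        also have "\<dots> \<le> real d * real d * (K * real n ^ (d - 1))"
          using bad by (intro mult_left_mono) auto
        finally have *: "(real n / 2) * (real n / (8 * real d ^ 2)) * (real n / (2 * real d)) ^ (d - 2)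
            \<le> real d * real d * (K * real n ^ (d - 1))" .
        define q where "q = 16 * real d ^ 2 * (2 * real d) ^ (d - 2)"
        have "real n ^ (d - 1) = real n * real n ^ (d - 2)"
          using d2 by (simp add: numeral_2_eq_2 Suc_diff_Suc flip: power_Suc)
        then have "(real n / 2) * (real n / (8 * real d ^ 2)) * (real n / (2 * real d)) ^ (d - 2)
            = real n * real n ^ (d - 1) / q"
          unfolding q_def by (simp add: power_divide)
        moreover have "q > 0" using d2 unfolding q_def by simp
        ultimately have "real n * real n ^ (d - 1) \<le> real d * real d * (K * real n ^ (d - 1)) * q"
          using * by (simp only: pos_divide_le_eq)
        then have "real n * real n ^ (d - 1) \<le> 16 * real d ^ 4 * K * (2 * real d) ^ (d - 2) * real n ^ (d - 1)"
          unfolding q_def by (simp add: power2_eq_square power4_eq_xxxx mult_ac)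
        then have "real n \<le> 16 * real d ^ 4 * K * (2 * real d) ^ (d - 2)" using n2 by simp
        then show False using nP P1 by linarith
      qed
      define r where "r = n - 1 - card (D x)"
      have r: "real r \<le> real n / (4 * real d ^ 2)"
      proof -
        have "real r \<le> real (n - card Big) + real (card Big - card (D x))"
          unfolding r_def using cB cD by linarith
        also have "\<dots> \<le> real n / (8 * real d ^ 2) + real n / (8 * real d ^ 2)"
          using few large by (rule add_mono)
        finally show ?thesis by (simp add: field_simps)
      qed
      \<comment> \<open>The bound on \<open>r\<close> is split into two factors: one matches the
        main term, the other contributes \<open>(1 / (2 * real d)) ^ (d - 1)\<close>, which absorbs
        the factor \<open>d\<close> because \<open>d \<ge> 2\<close>.\<close>
      have "real d * real r ^ (d - 1) \<le> real d * ((real n / (2 * real d)) * (1 / (2 * real d))) ^ (d - 1)"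
        using r by (intro mult_left_mono power_mono) (auto simp: field_simps power2_eq_square)
      also have "\<dots> = real d * (1 / (2 * real d)) ^ (d - 1) * (real n / (2 * real d)) ^ (d - 1)"
        by (simp only: power_mult_distrib mult_ac)
      also have "\<dots> \<le> (1 / 2) * (real n / (2 * real d)) ^ (d - 1)"
      proof (rule mult_right_mono)
        have "(1 / (2 * real d)) ^ (d - 1) \<le> (1 / (2 * real d)) ^ 1"
          using d2 by (intro power_decreasing) auto
        then show "real d * (1 / (2 * real d)) ^ (d - 1) \<le> 1 / 2"
          using d2 by (simp add: field_simps)
      qed simp
      also have "\<dots> = C * real n ^ (d - 1)"
        unfolding C_def by (simp add: power_divide field_simps)
      finally have up: "real d * real r ^ (d - 1) \<le> C * real n ^ (d - 1)" .
      have lo: "2 * (C * real n ^ (d - 1)) \<le> real (card (D x) choose (d - 1))"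
      proof -
        have D2: "real (card (D x)) \<ge> real n / 2" using few large le32 cB cD by linarith
        have "2 * (C * real n ^ (d - 1)) = (real n / 2 / real d) ^ (d - 1)"
          unfolding C_def by (simp add: power_divide power_mult_distrib field_simps)
        also have "\<dots> \<le> (real (card (D x)) / real (d - 1)) ^ (d - 1)"
          using D2 d2 by (intro power_mono frac_le) auto
        also have "\<dots> \<le> real (card (D x) choose (d - 1))"
          using D2 dn by (intro binomial_ge_n_over_k_pow_k) linarith
        finally show ?thesis .
      qed
      \<comment> \<open>A member missing \<open>x\<close> would cost at least
        \<open>2 * C - C = C\<close> units of \<open>n ^ (d - 1)\<close>, against the case
        assumption.\<close>
      have "\<forall>F\<in>\<F>. x \<in> F"
      proof (rule ccontr)
        assume "\<not> ?thesis"
        then obtain F0 where F0: "F0 \<in> \<F>" "x \<notin> F0" by auto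
        have pos: "C * real n ^ (d - 1) \<ge> 0" using C by simp
        have "real d * real r ^ (d - 1) \<le> real (card (D x) choose (d - 1))"
          using up lo pos by linarith
        from card_family_not_star[OF x F0 r_def this] show False
          using False up lo by linarith
      qed
      then show ?thesis using card_star by blast
    qed simp
  qed
  have weaken: "card \<F> \<le> (n - 1) choose d"
    if "real (card \<F>) \<le> real ((n - 1) choose d) - C * real n ^ (d - 1)" for n and \<F> :: "nat set set"
  proof -
    have "C * real n ^ (d - 1) \<ge> 0" using C by simp
    then show ?thesis using that by linarith
  qed
  show ?thesis
  proof (intro exI[of _ n0] exI[of _ C] conjI allI impI)
    fix n \<F>
    assume "n \<ge> n0" "\<F> \<subseteq> ksubsets n (d + 1)"
      "\<forall>F\<in>\<F>. \<exists>B. B \<subseteq> F \<and> card B = 1 \<and> (\<forall>F'\<in>\<F>. F \<inter> F' \<noteq> B)"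
    note alternatives = main[OF this]
    then show "card \<F> \<le> (n - 1) choose d" using weaken by (elim disjE conjE)
    show "(\<exists>x. \<forall>F\<in>\<F>. x \<in> F) \<and> card \<F> \<le> (n - 1) choose d
        \<or> real (card \<F>) \<le> real ((n - 1) choose d) - C * real n ^ (d - 1)"
      by (rule alternatives)
  qed (rule C(1))
qed

end
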